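(* Let $A=(a_{ij})\in\mathbf{RM}_7$ and $\xi_j=(|a_{j,j+1}|-|a_{j+1,j}|)^2/4$, $j=1,\dots,6$. Then $C(A)$ contains an ellipse with the foci $\pm\sqrt2$ if and only if either $$\xi_1+\xi_2=\xi_5+\xi_6$$ or $$\begin{cases}\xi_1^2+2\xi_2\xi_1-2\xi_3\xi_1-2\xi_4\xi_1+\xi_2^2-\xi_5^2-\xi_6^2+2\xi_2\xi_3-2\xi_2\xi_4+2\xi_3\xi_5-2\xi_4\xi_5+2\xi_3\xi_6+2\xi_4\xi_6-2\xi_5\xi_6=0,\\ \xi_2+\xi_3=\xi_4+\xi_5.\end{cases}$$
   Context: $\mathbf{RM}_7$ is the set of complex $7\times 7$ tridiagonal matrices $A=(a_{ij})$ with zero main diagonal and $a_{i,i+1}a_{i+1,i}=1$ for $i=1,\dots,6$ (reciprocal matrices). For a square matrix $A$, $\operatorname{Re}A=(A+A^* )/2$; the Kippenhahn polynomial of $A$ is $P_A(\lambda,\theta)=\det(\operatorname{Re}(e^{i\theta}A)-\lambda I)$, and the Kippenhahn curve $C(A)$ is the envelope of the family of lines $\{e^{-i\theta}(\lambda_j(\theta)+i\mathbb R):\theta\in(-\pi,\pi],\ j=1,\dots,7\}$, where $\lambda_j(\theta)$ are the roots of $P_A(\cdot,\theta)$.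
   Formalization: An ellipse with foci ±√2 is allowed to degenerate to the pair of foci (all lines through √2 and through −√2 belong to the family); for genuine ellipses only, the "if" part fails when ξ1=ξ2=ξ5=ξ6=0, e.g. when all ξj=0 and C(A) is seven points. *)

theory Defs
  imports "Jordan_Normal_Form.Schur_Decomposition"
begin

(* Rows and columns are numbered from 0. *)
definition reciprocal_matrices :: "nat \<Rightarrow> complex mat set" where
  "reciprocal_matrices n = {A \<in> carrier_mat n n.
     (\<forall>i<n. \<forall>j<n. i \<noteq> Suc j \<and> j \<noteq> Suc i \<longrightarrow> A $$ (i, j) = 0) \<and>
     (\<forall>i. Suc i < n \<longrightarrow> A $$ (i, Suc i) * A $$ (Suc i, i) = 1)}"

definition Re_mat :: "complex mat \<Rightarrow> complex mat" where
  "Re_mat A = (1 / 2) \<cdot>\<^sub>m (A + mat_adjoint A)"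

definition kippenhahn_poly :: "complex mat \<Rightarrow> complex \<Rightarrow> real \<Rightarrow> complex" where
  "kippenhahn_poly A l \<theta> = det (Re_mat (cis \<theta> \<cdot>\<^sub>m A) - l \<cdot>\<^sub>m 1\<^sub>m (dim_row A))"

definition line :: "real \<Rightarrow> real \<Rightarrow> complex set" where
  "line \<theta> p = {cis (- \<theta>) * (of_real p + \<i> * of_real s) | s. s \<in> (UNIV :: real set)}"

(* Restricting to real p loses no root: the matrix Re_mat (cis \<theta> \<cdot>\<^sub>m A) is Hermitian. *)
definition kippenhahn_lines :: "complex mat \<Rightarrow> complex set set" where
  "kippenhahn_lines A =
     {line \<theta> p | \<theta> p. - pi < \<theta> \<and> \<theta> \<le> pi \<and> kippenhahn_poly A (of_real p) \<theta> = 0}"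

(* The line (line t p) has the equation F z t = Re (cis t * z) - p = 0. The envelope consists of
   the characteristic points of the branches t \<mapsto> line t (p t) of the family, i.e. of the
   solutions z of F z t = 0 and dF/dt z t = 0, where p = p t. Branches are local in t because the
   lines of the family need not be globally labelled in a differentiable way. *)
definition envelope :: "complex set set \<Rightarrow> complex set" where
  "envelope L = {z. \<exists>p \<theta>. (\<forall>\<^sub>F t in nhds \<theta>. line t (p t) \<in> L) \<and>
     Re (cis \<theta> * z) - p \<theta> = 0 \<and>
     ((\<lambda>t. Re (cis t * z) - p t) has_real_derivative 0) (at \<theta>)}"

definition kippenhahn_curve :: "complex mat \<Rightarrow> complex set" where
  "kippenhahn_curve A = envelope (kippenhahn_lines A)"

(* A genuine ellipse if dist f g < 2 * a. *)
definition ellipse :: "complex \<Rightarrow> complex \<Rightarrow> real \<Rightarrow> complex set" where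
  "ellipse f g a = {z. dist z f + dist z g = 2 * a}"

definition pencil :: "complex \<Rightarrow> complex set set" where
  "pencil f = {line \<theta> (Re (cis \<theta> * f)) | \<theta>. \<theta> \<in> (UNIV :: real set)}"

(* As curves enveloped by lines, ellipses with fixed foci f and g degenerate, when the minor axis
   shrinks to 0, to the pair of points {f, g}, enveloped by the pencils of all lines through f and
   through g (see envelope_pencil). This limiting case, which occurs for instance when A is
   Hermitian, counts as an ellipse. The degenerate ellipse is contained in the curve if it is
   a component of the envelope, i.e. the two pencils are part of the family; that the points f
   and g happen to lie on some other component is not enough. *)
definition kippenhahn_curve_contains_ellipse ::
    "complex mat \<Rightarrow> complex \<Rightarrow> complex \<Rightarrow> bool" where
  "kippenhahn_curve_contains_ellipse A f g \<longleftrightarrow>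
     (\<exists>a. dist f g < 2 * a \<and> ellipse f g a \<subseteq> kippenhahn_curve A) \<or>
     pencil f \<union> pencil g \<subseteq> kippenhahn_lines A"

lemma mem_line_iff: "z \<in> line \<theta> p \<longleftrightarrow> Re (cis \<theta> * z) = p"
proof
  assume "z \<in> line \<theta> p"
  then obtain s where "z = cis (- \<theta>) * (of_real p + \<i> * of_real s)"
    by (auto simp: line_def)
  then have "cis \<theta> * z = of_real p + \<i> * of_real s"
    by (simp add: mult.assoc [symmetric] cis_mult)
  then show "Re (cis \<theta> * z) = p" by simp
next
  assume *: "Re (cis \<theta> * z) = p"
  have "z = cis (- \<theta>) * (cis \<theta> * z)"
    by (simp add: mult.assoc [symmetric] cis_mult)
  also have "cis \<theta> * z = of_real p + \<i> * of_real (Im (cis \<theta> * z))"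
    using * by (simp add: complex_eq_iff)
  finally show "z \<in> line \<theta> p" unfolding line_def by blast
qed

lemma line_in_pencil_iff: "line \<theta> p \<in> pencil f \<longleftrightarrow> p = Re (cis \<theta> * f)"
proof
  assume "line \<theta> p \<in> pencil f"
  then have "f \<in> line \<theta> p" by (auto simp: pencil_def mem_line_iff)
  then show "p = Re (cis \<theta> * f)" by (simp add: mem_line_iff)
qed (auto simp: pencil_def)

lemma envelope_pencil: "envelope (pencil f) = {f}"
proof (intro equalityI subsetI)
  fix z assume "z \<in> envelope (pencil f)"
  then obtain p \<theta> where ev: "\<forall>\<^sub>F t in nhds \<theta>. p t = Re (cis t * f)"
    and 0: "Re (cis \<theta> * z) - p \<theta> = 0"
    and d: "((\<lambda>t. Re (cis t * z) - p t) has_real_derivative 0) (at \<theta>)"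
    by (auto simp: envelope_def line_in_pencil_iff)
  have p: "p \<theta> = Re (cis \<theta> * f)" using ev by (rule eventually_nhds_x_imp_x)
  have "\<forall>\<^sub>F t in nhds \<theta>. Re (cis t * z) - p t = Re (cis t * (z - f))"
    using ev by eventually_elim (simp add: algebra_simps)
  then have "((\<lambda>t. Re (cis t * (z - f))) has_real_derivative 0) (at \<theta>)"
    using d by (subst (asm) DERIV_cong_ev [OF refl _ refl]) auto
  moreover have "((\<lambda>t. Re (cis t * (z - f))) has_real_derivative - Im (cis \<theta> * (z - f))) (at \<theta>)"
    by (auto intro!: derivative_eq_intros simp: algebra_simps)
  ultimately have "Im (cis \<theta> * (z - f)) = 0"
    using DERIV_unique by fastforce
  moreover have "Re (cis \<theta> * (z - f)) = 0" using 0 p by (simp add: algebra_simps)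
  ultimately have "cis \<theta> * (z - f) = 0" by (simp add: complex_eq_iff)
  then show "z \<in> {f}" by simp
next
  fix z assume "z \<in> {f}"
  then show "z \<in> envelope (pencil f)"
    by (auto simp: envelope_def line_in_pencil_iff
        intro!: exI [of _ "\<lambda>t. Re (cis t * f)"])
qed

end

(* The squared moduli of the off-diagonal entries of Re (e^{i theta} A) are xi_j + tau with
   tau = cos^2 theta, so the lines of the family are given by a continuant in p whose nonzero roots
   satisfy a cubic equation in p^2 and tau. The tangents of the ellipse with foci +-sqrt 2 and
   squared minor semiaxis s satisfy p^2 = s + 2 tau; substituting this into the cubic gives a quadratic
   polynomial in tau, and elimination of s from the vanishing of its coefficients gives the two
   stated alternatives.

   It remains to see that an ellipse contained in the curve has its tangents in the family. For z in
   the curve, the polynomial f_z(m) describing the lines of slope dx/dy = m = tan theta through z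
   has a double root. Move z along the ellipse. If the double root m depended differentiably on z, the
   derivative of f_z(m) along the ellipse with m fixed would vanish; such a point z is obtained
   without any regularity of m by a countability argument. Because roots of continuants are simple, the
   line of slope m through z is then tangent to the ellipse. As this remains true after
   removing finitely many points z, infinitely many tangents of the ellipse belong to the family. *)
theory Submission
  imports Defs "HOL-Analysis.Derivative"
begin

subsection \<open>Families of polynomials with double roots\<close>

text \<open>A member of a countable base that meets \<open>T\<close> in a single point determines
  this point, so only countably many points of \<open>T\<close> are isolated.\<close>

lemma uncountable_imp_islimpt:
  fixes T :: "'a::second_countable_topology set"
  assumes "uncountable T"
  shows "\<exists>x\<in>T. x islimpt T"
proof (rule ccontr)
  assume not: "\<not> ?thesis"
  obtain B :: "'a set set" where B: "countable B" "topological_basis B"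
    using ex_countable_basis by blast
  have "\<exists>b\<in>B. b \<inter> T = {x}" if x: "x \<in> T" for x
  proof -
    have "\<not> x islimpt T" using not x by blast
    then obtain U where U: "open U" "x \<in> U" "\<forall>y\<in>T. y \<in> U \<longrightarrow> y = x"
      by (auto simp: islimpt_def)
    then obtain b where "b \<in> B" "x \<in> b" "b \<subseteq> U"
      using B(2) topological_basisE by blast
    with U x show ?thesis by blast
  qed
  then have "x \<in> (\<lambda>b. the_elem (b \<inter> T)) ` B" if "x \<in> T" for x
    using that by (metis imageI the_elem_eq)
  then have "T \<subseteq> (\<lambda>b. the_elem (b \<inter> T)) ` B" by blast
  with B(1) have "countable T" using countable_image countable_subset by metis
  with assms show False by contradiction
qed

text \<open>In finite dimension an injective \<open>L\<close> satisfies
  \<open>B * norm x \<le> norm (L x)\<close> for some \<open>B > 0\<close>. Close to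
  \<open>a\<close> this exceeds the error of the linear approximation, so \<open>f\<close> takes the
  value \<open>f a\<close> there only at \<open>a\<close>.\<close>

lemma inj_derivative_imp_not_islimpt:
  fixes f :: "'a::euclidean_space \<Rightarrow> 'b::euclidean_space"
  assumes f: "(f has_derivative L) (at a)" and "inj L"
  shows "\<not> a islimpt {y. f y = f a}"
proof
  assume lim: "a islimpt {y. f y = f a}"
  have "linear L" using f has_derivative_linear by blast
  then obtain B where B: "B > 0" "\<And>x. B * norm x \<le> norm (L x)"
    using linear_inj_bounded_below_pos \<open>inj L\<close> by blast
  from f B(1) obtain d where d: "d > 0"
    "\<And>y. norm (y - a) < d \<Longrightarrow> norm (f y - f a - L (y - a)) \<le> B / 2 * norm (y - a)"
    unfolding has_derivative_at_alt by (metis half_gt_zero)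
  obtain y where y: "f y = f a" "y \<noteq> a" "dist y a < d"
    using lim d(1) unfolding islimpt_approachable by blast
  then have "norm (L (y - a)) \<le> B / 2 * norm (y - a)"
    using d(2)[of y] by (simp add: dist_norm)
  moreover have "B * norm (y - a) \<le> norm (L (y - a))" by (rule B)
  ultimately have "B * norm (y - a) \<le> 0" by simp
  with B(1) y(2) show False by (simp add: mult_le_0_iff)
qed

text \<open>The uniform degree bound turns evaluation into a sum over a fixed finite range, which
  can be differentiated termwise.\<close>

definition differentiable_coeffs :: "(real \<Rightarrow> real poly) \<Rightarrow> bool" where
  "differentiable_coeffs F \<longleftrightarrow>
     (\<forall>i s. (\<lambda>u. coeff (F u) i) differentiable at s) \<and> (\<exists>N. \<forall>u. degree (F u) \<le> N)"

lemma differentiable_coeffs_const: "differentiable_coeffs (\<lambda>u. p)"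
  by (auto simp: differentiable_coeffs_def)

lemma differentiable_coeffs_pCons:
  assumes "\<And>s. f differentiable at s" "differentiable_coeffs F"
  shows "differentiable_coeffs (\<lambda>u. pCons (f u) (F u))"
proof -
  obtain N where N: "\<forall>u. degree (F u) \<le> N"
    using assms(2) unfolding differentiable_coeffs_def by blast
  have "degree (pCons (f u) (F u)) \<le> Suc N" for u
    using N degree_pCons_le[of "f u" "F u"] by (meson Suc_le_mono order_trans)
  moreover have "(\<lambda>u. coeff (pCons (f u) (F u)) i) differentiable at s" for i s
    using assms by (cases i) (auto simp: differentiable_coeffs_def)
  ultimately show ?thesis unfolding differentiable_coeffs_def by blast
qed

lemma differentiable_coeffs_diff:
  assumes "differentiable_coeffs F" "differentiable_coeffs G"
  shows "differentiable_coeffs (\<lambda>u. F u - G u)"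
proof -
  obtain M N where "\<forall>u. degree (F u) \<le> M" "\<forall>u. degree (G u) \<le> N"
    using assms unfolding differentiable_coeffs_def by blast
  then have "degree (F u - G u) \<le> max M N" for u
    by (intro degree_diff_le_max[THEN order_trans] max.mono) auto
  with assms show ?thesis by (auto simp: differentiable_coeffs_def)
qed

lemma differentiable_coeffs_mult:
  assumes "differentiable_coeffs F" "differentiable_coeffs G"
  shows "differentiable_coeffs (\<lambda>u. F u * G u)"
proof -
  obtain M N where "\<forall>u. degree (F u) \<le> M" "\<forall>u. degree (G u) \<le> N"
    using assms unfolding differentiable_coeffs_def by blast
  then have "degree (F u * G u) \<le> M + N" for u
    by (intro degree_mult_le[THEN order_trans] add_mono) auto
  with assms show ?thesis
    by (auto simp: differentiable_coeffs_def coeff_mult intro!: derivative_intros)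
qed

lemma differentiable_coeffs_pderiv:
  assumes "differentiable_coeffs F"
  shows "differentiable_coeffs (\<lambda>u. pderiv (F u))"
proof -
  obtain N where "\<forall>u. degree (F u) \<le> N"
    using assms unfolding differentiable_coeffs_def by blast
  then have "degree (pderiv (F u)) \<le> N" for u
    by (simp add: degree_pderiv le_diff_conv le_SucI)
  with assms show ?thesis
    by (auto simp: differentiable_coeffs_def coeff_pderiv)
qed

lemma differentiable_coeffs_pderiv_iter:
  "differentiable_coeffs F \<Longrightarrow> differentiable_coeffs (\<lambda>u. (pderiv ^^ k) (F u))"
  by (induction k) (auto intro: differentiable_coeffs_pderiv)

text \<open>The derivative is total in parameter and argument, so that it applies along the graph of
  a root function that need not even be continuous. \<open>c\<close> is the partial derivative with
  the argument frozen.\<close>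

lemma differentiable_coeffs_has_derivative:
  assumes "differentiable_coeffs F"
  shows "\<exists>c. ((\<lambda>y. poly (F (fst y)) (snd y)) has_derivative
      (\<lambda>h. c * fst h + poly (pderiv (F s)) x * snd h)) (at (s, x)) \<and>
    ((\<lambda>u. poly (F u) x) has_real_derivative c) (at s)"
proof -
  obtain N where N: "\<And>u. degree (F u) \<le> N"
    using assms unfolding differentiable_coeffs_def by blast
  have "\<forall>i. \<exists>d. ((\<lambda>u. coeff (F u) i) has_real_derivative d) (at s)"
    using assms unfolding differentiable_coeffs_def real_differentiable_def by blast
  then obtain c where c: "\<And>i. ((\<lambda>u. coeff (F u) i) has_real_derivative c i) (at s)"
    by (auto dest!: choice)
  have poly_F: "poly (F u) y = (\<Sum>i\<le>N. coeff (F u) i * y ^ i)" for u y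
    unfolding poly_altdef using N
    by (intro sum.mono_neutral_left) (auto simp: coeff_eq_0)
  have *: "((\<lambda>y. \<Sum>i\<le>N. coeff (F s) i * y ^ i) has_real_derivative
      (\<Sum>i\<le>N. coeff (F s) i * (of_nat i * x ^ (i - 1)))) (at x)"
    by (intro DERIV_sum DERIV_cmult) (use DERIV_pow[of _ x UNIV] in simp)
  have "((\<lambda>y. poly (F s) y) has_real_derivative
      (\<Sum>i\<le>N. coeff (F s) i * (of_nat i * x ^ (i - 1)))) (at x)"
    using * unfolding poly_F .
  then have pd: "poly (pderiv (F s)) x = (\<Sum>i\<le>N. coeff (F s) i * (of_nat i * x ^ (i - 1)))"
    by (rule DERIV_unique[OF poly_DERIV])
  have cd: "((\<lambda>y. coeff (F (fst y)) i) has_derivative (\<lambda>h. c i * fst h)) (at (s, x))" for i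
    using has_derivative_compose[of fst fst "(s, x)" UNIV "\<lambda>u. coeff (F u) i" "(*) (c i)"]
      c[of i] has_derivative_fst[OF has_derivative_ident, of "at (s, x)"]
    by (simp add: has_field_derivative_def)
  have pow: "((\<lambda>y::real \<times> real. snd y ^ i) has_derivative (\<lambda>h. (of_nat i * x ^ (i - 1)) * snd h)) (at (s, x))" for i
    by (auto intro!: derivative_eq_intros simp: fun_eq_iff)
  have "((\<lambda>y. coeff (F (fst y)) i * snd y ^ i) has_derivative
      (\<lambda>h. coeff (F s) i * ((of_nat i * x ^ (i - 1)) * snd h) + c i * fst h * x ^ i)) (at (s, x))" for i
    using has_derivative_mult[OF cd pow, of i i] by simp
  then have "((\<lambda>y. \<Sum>i\<le>N. coeff (F (fst y)) i * snd y ^ i) has_derivative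
      (\<lambda>h. \<Sum>i\<le>N. coeff (F s) i * ((of_nat i * x ^ (i - 1)) * snd h) + c i * fst h * x ^ i)) (at (s, x))"
    by (rule has_derivative_sum)
  then have "((\<lambda>y. \<Sum>i\<le>N. coeff (F (fst y)) i * snd y ^ i) has_derivative
      (\<lambda>h. (\<Sum>i\<le>N. c i * x ^ i) * fst h + poly (pderiv (F s)) x * snd h)) (at (s, x))"
    by (rule has_derivative_eq_rhs)
      (simp add: pd fun_eq_iff sum.distrib sum_distrib_left mult_ac)
  moreover have "((\<lambda>u. \<Sum>i\<le>N. coeff (F u) i * x ^ i) has_real_derivative (\<Sum>i\<le>N. c i * x ^ i)) (at s)"
    by (intro DERIV_sum DERIV_cmult_right c)
  ultimately show ?thesis unfolding poly_F by blast
qed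

lemma double_roots_stationary:
  fixes F :: "real \<Rightarrow> real poly"
  assumes F: "differentiable_coeffs F" and S: "uncountable S"
    and nz: "\<And>s. s \<in> S \<Longrightarrow> F s \<noteq> 0"
    and root: "\<And>s. s \<in> S \<Longrightarrow> poly (F s) (m s) = 0"
    and double: "\<And>s. s \<in> S \<Longrightarrow> poly (pderiv (F s)) (m s) = 0"
  shows "\<exists>s\<in>S. ((\<lambda>u. poly (F u) (m s)) has_real_derivative 0) (at s)"
proof -
  text \<open>The multiplicity of the double root may jump, but it is constant on an uncountable subset of
    \<open>S\<close>. At an accumulation point of the corresponding graph, \<open>F\<close> together with the last vanishing
    derivative of \<open>F\<close> would be locally injective if the derivative of \<open>F\<close> in the direction of the
    parameter were not zero.\<close>
  define D where "D k s = poly ((pderiv ^^ k) (F s)) (m s)" for k s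
  have iter_degree: "degree ((pderiv ^^ k) p) = degree p - k" for k and p :: "real poly"
    by (induction k) (auto simp: degree_pderiv)
  have iter_nz: "(pderiv ^^ k) p \<noteq> 0" if "k \<le> degree p" "p \<noteq> 0" for k and p :: "real poly"
    using that by (induction k) (auto simp: pderiv_eq_0_iff iter_degree)
  \<comment> \<open>The derivative of order \<open>degree (F s)\<close> is a nonzero
    constant.\<close>
  have ex: "\<exists>k. D k s \<noteq> 0" if "s \<in> S" for s
  proof -
    let ?p = "(pderiv ^^ degree (F s)) (F s)"
    have "degree ?p = 0" "?p \<noteq> 0" using nz[OF that] by (auto simp: iter_degree iter_nz)
    then have "D (degree (F s)) s \<noteq> 0" unfolding D_def
      by (metis degree_eq_zeroE poly_pCons mult_zero_right poly_0 add_0_right pCons_0_0)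
    then show ?thesis ..
  qed
  \<comment> \<open>This is the multiplicity of the root \<open>m s\<close> of
    \<open>F s\<close>.\<close>
  define k where "k s = (LEAST k. D k s \<noteq> 0)" for s
  have k: "D (k s) s \<noteq> 0" if "s \<in> S" for s
    unfolding k_def using LeastI_ex[OF ex[OF that]] .
  have k_less: "D j s = 0" if "j < k s" for j s
    using not_less_Least that unfolding k_def by blast
  have D01: "D 0 s = 0" "D (Suc 0) s = 0" if "s \<in> S" for s
    using root double that by (auto simp: D_def)
  have "S = (\<Union>n. {s \<in> S. k s = n})" by auto
  then obtain n where n: "uncountable {s \<in> S. k s = n}"
    using S countable_UN[of UNIV "\<lambda>n. {s \<in> S. k s = n}"] by (metis countableI_type)
  define T where "T = (\<lambda>s. (s, m s)) ` {s \<in> S. k s = n}"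
  have "inj_on (\<lambda>s. (s, m s)) {s \<in> S. k s = n}" by (auto simp: inj_on_def)
  then have "uncountable T" unfolding T_def using n countable_image_inj_on by blast
  then obtain a where a: "a \<in> T" "a islimpt T" using uncountable_imp_islimpt by blast
  then obtain s where s: "s \<in> S" "k s = n" and a_eq: "a = (s, m s)" by (auto simp: T_def)
  obtain j where j: "n = Suc j"
    using k[OF s(1)] D01[OF s(1)] s(2) by (cases n) auto
  \<comment> \<open>The order \<open>j\<close> is one less than the multiplicity, so
    \<open>m u\<close> is a simple root of \<open>G u\<close> whenever \<open>(u, m u)\<close> lies
    in \<open>T\<close>.\<close>
  define G where "G u = (pderiv ^^ j) (F u)" for u
  obtain c where c: "((\<lambda>y. poly (F (fst y)) (snd y)) has_derivative
      (\<lambda>h. c * fst h + poly (pderiv (F s)) (m s) * snd h)) (at (s, m s))"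
    "((\<lambda>u. poly (F u) (m s)) has_real_derivative c) (at s)"
    using differentiable_coeffs_has_derivative[OF F] by blast
  obtain d where d: "((\<lambda>y. poly (G (fst y)) (snd y)) has_derivative
      (\<lambda>h. d * fst h + poly (pderiv (G s)) (m s) * snd h)) (at (s, m s))"
    using differentiable_coeffs_has_derivative[OF differentiable_coeffs_pderiv_iter[OF F]]
    unfolding G_def by blast
  have Gnz: "poly (pderiv (G s)) (m s) \<noteq> 0"
    using k[OF s(1)] s(2) by (simp add: G_def D_def j)
  let ?f = "\<lambda>y. (poly (F (fst y)) (snd y), poly (G (fst y)) (snd y))"
  \<comment> \<open>At a double root the derivative of \<open>F\<close> in the direction of the
    argument vanishes. Hence \<open>?L\<close> is triangular, with diagonal entries \<open>c\<close>
    and \<open>poly (pderiv (G s)) (m s)\<close>.\<close>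
  let ?L = "\<lambda>h. (c * fst h, d * fst h + poly (pderiv (G s)) (m s) * snd h)"
  have L: "(?f has_derivative ?L) (at a)"
    using has_derivative_Pair[OF c(1) d] double[OF s(1)] by (simp add: a_eq)
  have f0: "?f y = (0, 0)" if y: "y \<in> T" for y
  proof -
    obtain u where u: "u \<in> S" "k u = n" "y = (u, m u)" using y by (auto simp: T_def)
    then have "D j u = 0" using k_less[of j u] j by simp
    then show ?thesis using u root by (simp add: G_def D_def)
  qed
  have "a islimpt {y. ?f y = ?f a}"
    by (rule islimpt_subset[OF a(2)]) (use f0 a(1) in auto)
  then have "\<not> inj ?L" using inj_derivative_imp_not_islimpt[OF L] by blast
  moreover have "inj ?L" if "c \<noteq> 0"
    using that Gnz by (auto simp: inj_on_def prod_eq_iff)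
  ultimately have "c = 0" by blast
  with c(2) s(1) show ?thesis by blast
qed

subsection \<open>Continuants and the Kippenhahn polynomial\<close>

text \<open>The determinant of a tridiagonal matrix with constant diagonal \<open>x\<close>; \<open>q j\<close> is the product of the
  two off-diagonal entries joining the indices \<open>j - 1\<close> and \<open>j\<close>, so \<open>q 0\<close> is never used.\<close>

fun continuant :: "(nat \<Rightarrow> 'a::comm_ring_1) \<Rightarrow> 'a \<Rightarrow> nat \<Rightarrow> 'a" where
  "continuant q x 0 = 1"
| "continuant q x (Suc 0) = x"
| "continuant q x (Suc (Suc n)) = x * continuant q x (Suc n) - q (Suc n) * continuant q x n"

lemma continuant_cong:
  "(\<And>j. 1 \<le> j \<Longrightarrow> j < n \<Longrightarrow> q j = r j) \<Longrightarrow> continuant q x n = continuant r x n"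
  by (induction q x n rule: continuant.induct) auto

lemma continuant_minus: "continuant q (- x) n = (- 1) ^ n * continuant q x n"
  by (induction q x n rule: continuant.induct) (auto simp: algebra_simps)

lemma continuant_scale: "continuant (\<lambda>j. c\<^sup>2 * q j) (c * x) n = c ^ n * continuant q x n"
  by (induction q x n rule: continuant.induct) (auto simp: algebra_simps power2_eq_square)

lemma continuant_of_real:
  "continuant (\<lambda>j. of_real (q j)) (of_real x) n = of_real (continuant q x n)"
  by (induction q x n rule: continuant.induct) auto

lemma poly_continuant:
  "poly (continuant q p n) x = continuant (\<lambda>j. poly (q j) x) (poly p x) n"
  by (induction q p n rule: continuant.induct) auto

text \<open>The coefficients are sums over sets of pairwise nonadjacent indices, i.e. over the
  matchings of a path with seven vertices.\<close>

lemma continuant_7: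
  "continuant q x 7 = x * (x ^ 6 - (q 1 + q 2 + q 3 + q 4 + q 5 + q 6) * x ^ 4
    + (q 1 * q 3 + q 1 * q 4 + q 1 * q 5 + q 1 * q 6 + q 2 * q 4 + q 2 * q 5 + q 2 * q 6
       + q 3 * q 5 + q 3 * q 6 + q 4 * q 6) * x\<^sup>2
    - (q 1 * q 3 * q 5 + q 1 * q 3 * q 6 + q 1 * q 4 * q 6 + q 2 * q 4 * q 6))"
  for x :: "'a::comm_ring_1"
proof -
  have "7 = Suc (Suc (Suc (Suc (Suc (Suc (Suc 0))))))" by simp
  then have "continuant q x 7 = continuant q x (Suc (Suc (Suc (Suc (Suc (Suc (Suc 0)))))))" by metis
  then show ?thesis
    by (simp add: numeral_eq_Suc algebra_simps)
qed

text \<open>Laplace expansion of the leading principal blocks along the last row yields the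
  recursion of \<open>continuant\<close>.\<close>

lemma det_tridiagonal:
  fixes A :: "'a::comm_ring_1 mat"
  assumes "A \<in> carrier_mat n n"
    and "\<And>i. i < n \<Longrightarrow> A $$ (i, i) = x"
    and "\<And>i j. i < n \<Longrightarrow> j < n \<Longrightarrow> i \<noteq> j \<Longrightarrow> i \<noteq> Suc j \<Longrightarrow> j \<noteq> Suc i \<Longrightarrow> A $$ (i, j) = 0"
  shows "det A = continuant (\<lambda>j. A $$ (j - 1, j) * A $$ (j, j - 1)) x n"
proof -
  define T where "T n = Matrix.mat n n (\<lambda>ij. A $$ ij)" for n
  have T: "T k \<in> carrier_mat k k" for k by (simp add: T_def)
  have minor: "mat_delete (T (Suc k)) k k = T k" for k
    by (rule eq_matI) (auto simp: T_def mat_delete_def)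
  have "det (T k) = continuant (\<lambda>j. A $$ (j - 1, j) * A $$ (j, j - 1)) x k" if "k \<le> n" for k
    using that
  proof (induction k rule: less_induct)
    case (less k)
    consider "k = 0" | "k = 1" | l where "k = Suc (Suc l)"
      by (metis One_nat_def not0_implies_Suc)
    then show ?case
    proof cases
      case 1
      then show ?thesis by (simp add: T_def)
    next
      case 2
      then show ?thesis using less.prems assms(2)[of 0] by (simp add: T_def det_single)
    next
      case (3 l)
      \<comment> \<open>\<open>?B\<close> is the minor belonging to the subdiagonal entry of the
        last row. In its last column only \<open>A $$ (l, Suc l)\<close> can be nonzero, so a second
        expansion leads to \<open>T l\<close>.\<close>
      let ?M = "T (Suc (Suc l))" and ?B = "mat_delete (T (Suc (Suc l))) (Suc l) l"
      have le: "Suc (Suc l) \<le> n" using 3 less.prems by simp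
      have B: "?B \<in> carrier_mat (Suc l) (Suc l)" by (simp add: T_def mat_delete_def)
      have B_ll: "?B $$ (l, l) = A $$ (l, Suc l)" by (simp add: T_def mat_delete_def)
      have B_0: "?B $$ (i, l) = 0" if "i < l" for i
        using that le assms(3)[of i "Suc l"] by (simp add: T_def mat_delete_def)
      have "mat_delete ?B l l = T l"
        by (rule eq_matI) (auto simp: T_def mat_delete_def)
      then have "cofactor ?B l l = det (T l)" by (simp add: cofactor_def)
      moreover have "det ?B = (\<Sum>i<Suc l. ?B $$ (i, l) * cofactor ?B i l)"
        by (rule laplace_expansion_column[OF B]) simp
      ultimately have det_B: "det ?B = A $$ (l, Suc l) * det (T l)"
        by (simp add: B_ll B_0)
      have M_0: "?M $$ (Suc l, j) = 0" if "j < l" for j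
        using that le assms(3)[of "Suc l" j] by (simp add: T_def)
      have "det ?M = (\<Sum>j<Suc (Suc l). ?M $$ (Suc l, j) * cofactor ?M (Suc l) j)"
        by (rule laplace_expansion_row[OF T]) simp
      also have "\<dots> = ?M $$ (Suc l, Suc l) * cofactor ?M (Suc l) (Suc l)
          + ?M $$ (Suc l, l) * cofactor ?M (Suc l) l"
        by (simp add: M_0)
      also have "\<dots> = x * det (T (Suc l)) - A $$ (Suc l, l) * det ?B"
        using le assms(2)[of "Suc l"] by (simp add: cofactor_def minor) (simp add: T_def)
      finally show ?thesis
        using less.IH[of l] less.IH[of "Suc l"] le 3 by (simp add: det_B algebra_simps)
    qed
  qed
  moreover have "T n = A" using assms(1) by (intro eq_matI) (auto simp: T_def)
  ultimately show ?thesis by blast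
qed

text \<open>The two factors are conjugate, so the product is the squared modulus (|a|^2 + |b|^2 + 2
  cos 2t) / 4, and |a| |b| = 1 completes the square.\<close>

lemma reciprocal_off_diagonal:
  fixes a b :: complex
  assumes "a * b = 1"
  shows "(1 / 2 * (cis t * a + cnj (cis t * b))) * (1 / 2 * (cis t * b + cnj (cis t * a)))
    = of_real ((cmod a - cmod b)\<^sup>2 / 4 + (cos t)\<^sup>2)"
proof -
  have n: "cmod a * cmod b = 1" using assms by (metis norm_mult norm_one)
  have sq: "a * cnj a = of_real ((cmod a)\<^sup>2)" "b * cnj b = of_real ((cmod b)\<^sup>2)"
    by (simp_all add: complex_norm_square[symmetric])
  have c: "cis t * cnj (cis t) = 1" "cis t + cnj (cis t) = of_real (2 * cos t)"
    by (simp_all add: complex_eq_iff power2_eq_square[symmetric])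
  have ab: "cnj a * cnj b = 1" using assms by (metis complex_cnj_mult complex_cnj_one)
  have "4 * ((1 / 2 * (cis t * a + cnj (cis t * b))) * (1 / 2 * (cis t * b + cnj (cis t * a))))
      = (cis t)\<^sup>2 * (a * b) + (cis t * cnj (cis t)) * (a * cnj a + b * cnj b) + (cnj (cis t))\<^sup>2 * (cnj a * cnj b)"
    by (simp add: algebra_simps power2_eq_square)
  also have "\<dots> = (cis t + cnj (cis t))\<^sup>2 - 2 * (cis t * cnj (cis t)) + (a * cnj a + b * cnj b)"
    unfolding assms ab c(1) by (simp add: algebra_simps power2_eq_square) (simp add: algebra_simps c(1)[simplified])
  also have "\<dots> = of_real ((2 * cos t)\<^sup>2 - 2 * (cmod a * cmod b) + (cmod a)\<^sup>2 + (cmod b)\<^sup>2)"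
    unfolding c sq n by simp
  also have "(2 * cos t)\<^sup>2 - 2 * (cmod a * cmod b) + (cmod a)\<^sup>2 + (cmod b)\<^sup>2
      = 4 * ((cmod a - cmod b)\<^sup>2 / 4 + (cos t)\<^sup>2)"
    by (simp add: power2_eq_square field_simps)
  finally show ?thesis by simp
qed

lemma kippenhahn_poly_continuant:
  assumes "A \<in> reciprocal_matrices n"
    and "\<And>j. 1 \<le> j \<Longrightarrow> j < n \<Longrightarrow>
      \<xi> j = (cmod (A $$ (j - 1, j)) - cmod (A $$ (j, j - 1)))\<^sup>2 / 4"
  shows "kippenhahn_poly A (of_real p) t
    = of_real ((- 1) ^ n * continuant (\<lambda>j. \<xi> j + (cos t)\<^sup>2) p n)"
proof -
  have A: "A \<in> carrier_mat n n"
    and zero: "\<And>i j. i < n \<Longrightarrow> j < n \<Longrightarrow> i \<noteq> Suc j \<Longrightarrow> j \<noteq> Suc i \<Longrightarrow> A $$ (i, j) = 0"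
    and one: "\<And>i. Suc i < n \<Longrightarrow> A $$ (i, Suc i) * A $$ (Suc i, i) = 1"
    using assms(1) by (auto simp: reciprocal_matrices_def)
  define H where "H = Re_mat (cis t \<cdot>\<^sub>m A) - of_real p \<cdot>\<^sub>m 1\<^sub>m (dim_row A)"
  have dim: "dim_row A = n" "dim_col A = n" using A by auto
  have H: "H \<in> carrier_mat n n" using A by (auto simp: H_def)
  have adj: "mat_adjoint (cis t \<cdot>\<^sub>m A) $$ (i, j) = cnj (cis t * A $$ (j, i))"
    "dim_row (mat_adjoint (cis t \<cdot>\<^sub>m A)) = n"
    "dim_col (mat_adjoint (cis t \<cdot>\<^sub>m A)) = n" if "i < n" "j < n" for i j
    using that dim by (auto simp: mat_adjoint_def mat_of_rows_def)
  have entry: "H $$ (i, j) = 1 / 2 * (cis t * A $$ (i, j) + cnj (cis t * A $$ (j, i)))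
      - (if i = j then of_real p else 0)" if "i < n" "j < n" for i j
    using that dim by (simp add: H_def Re_mat_def adj)
  \<comment> \<open>The fact \<open>zero\<close> includes \<open>i = j\<close>, so the diagonal of
    \<open>H\<close> is constantly \<open>- p\<close>; this is the source of the factor
    \<open>(- 1) ^ n\<close>.\<close>
  have "det H = continuant (\<lambda>j. H $$ (j - 1, j) * H $$ (j, j - 1)) (of_real (- p)) n"
    by (rule det_tridiagonal[OF H]) (auto simp: entry zero)
  also have "\<dots> = continuant (\<lambda>j. of_real (\<xi> j + (cos t)\<^sup>2)) (of_real (- p)) n"
  proof (rule continuant_cong)
    fix j assume j: "1 \<le> j" "j < n"
    then have "A $$ (j - 1, j) * A $$ (j, j - 1) = 1" using one[of "j - 1"] by simp
    from reciprocal_off_diagonal[OF this, of t]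
    show "H $$ (j - 1, j) * H $$ (j, j - 1) = of_real (\<xi> j + (cos t)\<^sup>2)"
      using j by (cases j) (simp_all add: entry assms(2))
  qed
  also have "\<dots> = of_real (continuant (\<lambda>j. \<xi> j + (cos t)\<^sup>2) (- p) n)"
    by (rule continuant_of_real)
  finally show ?thesis by (simp add: kippenhahn_poly_def H_def continuant_minus)
qed

text \<open>The Wronskian of consecutive continuants is a sum of squares with positive weights, so real
  roots are simple.\<close>

lemma continuant_Wronskian_pos:
  assumes q: "\<And>j. 1 \<le> j \<Longrightarrow> q j > 0"
  shows "\<exists>D. (\<forall>n. ((\<lambda>x. continuant q x n) has_real_derivative D n) (at x)) \<and>
    (\<forall>n. D (Suc n) * continuant q x n - continuant q x (Suc n) * D n > 0)"
proof -
  have "\<exists>d. ((\<lambda>x. continuant q x n) has_real_derivative d) (at x)" for n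
  proof (induction q x n rule: continuant.induct)
    case (3 q x n)
    then show ?case by (auto intro!: derivative_eq_intros)
  qed (auto intro!: derivative_eq_intros)
  then have "\<forall>n. \<exists>d. ((\<lambda>x. continuant q x n) has_real_derivative d) (at x)" by blast
  then obtain D where D: "\<And>n. ((\<lambda>x. continuant q x n) has_real_derivative D n) (at x)"
    by (auto dest!: choice)
  have D0: "D 0 = 0" by (rule DERIV_unique[OF D]) auto
  have D1: "D (Suc 0) = 1" by (rule DERIV_unique[OF D]) auto
  have D2: "D (Suc (Suc n)) = continuant q x (Suc n) + x * D (Suc n) - q (Suc n) * D n" for n
    by (rule DERIV_unique[OF D]) (auto intro!: derivative_eq_intros D)
  have "D (Suc n) * continuant q x n - continuant q x (Suc n) * D n > 0" for n
  proof (induction n)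
    case 0
    then show ?case by (simp add: D0 D1)
  next
    case (Suc n)
    have "D (Suc (Suc n)) * continuant q x (Suc n) - continuant q x (Suc (Suc n)) * D (Suc n)
      = (continuant q x (Suc n))\<^sup>2
        + q (Suc n) * (D (Suc n) * continuant q x n - continuant q x (Suc n) * D n)"
      by (simp add: D2 algebra_simps power2_eq_square)
    moreover have "q (Suc n) * (D (Suc n) * continuant q x n - continuant q x (Suc n) * D n) > 0"
      using Suc q[of "Suc n"] by simp
    ultimately show ?case by (simp add: add_nonneg_pos)
  qed
  with D show ?thesis by blast
qed

lemma continuant_simple_root:
  assumes "\<And>j. 1 \<le> j \<Longrightarrow> q j > 0" and "continuant q x (Suc n) = 0"
  obtains d where "((\<lambda>x. continuant q x (Suc n)) has_real_derivative d) (at x)" "d \<noteq> 0"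
proof -
  obtain D where D: "\<forall>n. ((\<lambda>x. continuant q x n) has_real_derivative D n) (at x)"
    "\<forall>n. D (Suc n) * continuant q x n - continuant q x (Suc n) * D n > 0"
    using continuant_Wronskian_pos[of q x, OF assms(1)] by blast
  have "D (Suc n) \<noteq> 0"
  proof
    assume "D (Suc n) = 0"
    with D(2) assms(2) show False by (metis diff_zero mult_zero_left order_less_irrefl)
  qed
  with D(1) that show thesis by blast
qed

subsection \<open>Tangents of an ellipse in the Kippenhahn curve\<close>

lemma continuant_eq_0_uminus: "continuant q (- x) n = 0 \<longleftrightarrow> continuant q x n = 0"
  for x :: "'a::idom"
  by (simp add: continuant_minus)

text \<open>As a polynomial in \<open>x\<close> the continuant is monic of degree
  \<open>n\<close>.\<close>

lemma finite_continuant_roots: "finite {x::real. continuant q x n = 0}"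
proof -
  define P where "P n = continuant (\<lambda>j. [:q j:]) [:0, 1:] n" for n
  have "degree (P n) \<le> n \<and> coeff (P n) n = 1"
  proof (induction n rule: induct_nat_012)
    case (ge2 n)
    have P: "P (Suc (Suc n)) = pCons 0 (P (Suc n)) - Polynomial.smult (q (Suc n)) (P n)"
      by (simp add: P_def)
    have "degree (P (Suc (Suc n))) \<le> Suc (Suc n)"
      unfolding P using ge2 degree_pCons_le[of 0 "P (Suc n)"]
      by (intro degree_diff_le degree_smult_le[THEN order_trans]) auto
    moreover have "coeff (P n) (Suc (Suc n)) = 0"
      using ge2 by (intro coeff_eq_0) auto
    ultimately show ?case using ge2 by (simp add: P)
  qed (auto simp: P_def)
  then have "P n \<noteq> 0" by auto
  then have "finite {x. poly (P n) x = 0}" by (rule poly_roots_finite)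
  then show ?thesis by (simp add: P_def poly_continuant)
qed

text \<open>By the chain rule only the value and the derivative of the argument at \<open>t\<close>
  matter. This allows a branch of the family to be replaced by the pencil through its characteristic
  point.\<close>

lemma continuant_tangent:
  fixes q :: "nat \<Rightarrow> real \<Rightarrow> real"
  assumes "(f has_real_derivative d) (at t)" "(g has_real_derivative d) (at t)" "f t = g t"
    and q: "\<And>j. q j differentiable at t"
  shows "\<exists>e. ((\<lambda>s. continuant (\<lambda>j. q j s) (f s) n) has_real_derivative e) (at t) \<and>
    ((\<lambda>s. continuant (\<lambda>j. q j s) (g s) n) has_real_derivative e) (at t)"
proof -
  show ?thesis
  proof (induction n rule: induct_nat_012)
    case 0
    then show ?case by (auto intro!: exI[of _ 0])
  next
    case 1
    then show ?case using assms by auto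
  next
    case (ge2 n)
    obtain r where r: "(q (Suc n) has_real_derivative r) (at t)"
      using q real_differentiable_def by blast
    from ge2 obtain e1 e2 where e:
      "((\<lambda>s. continuant (\<lambda>j. q j s) (f s) n) has_real_derivative e1) (at t)"
      "((\<lambda>s. continuant (\<lambda>j. q j s) (g s) n) has_real_derivative e1) (at t)"
      "((\<lambda>s. continuant (\<lambda>j. q j s) (f s) (Suc n)) has_real_derivative e2) (at t)"
      "((\<lambda>s. continuant (\<lambda>j. q j s) (g s) (Suc n)) has_real_derivative e2) (at t)"
      by blast
    show ?case
      unfolding continuant.simps
      using DERIV_diff[OF DERIV_mult[OF assms(1) e(3)] DERIV_mult[OF r e(1)]]
        DERIV_diff[OF DERIV_mult[OF assms(2) e(4)] DERIV_mult[OF r e(2)]] assms(3)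
      by auto
  qed
qed

text \<open>A line determines \<open>cis t\<close> and \<open>p\<close> up to a common sign: the
  equation holds for every point of the line, so the coefficient \<open>sin (t' - t)\<close> of
  \<open>s\<close> must vanish.\<close>

lemma line_eqD:
  assumes "line t p = line t' p'"
  shows "(cos t')\<^sup>2 = (cos t)\<^sup>2 \<and> (p' = p \<or> p' = - p)"
proof -
  have eq: "cos (t' - t) * p - sin (t' - t) * s = p'" for s
  proof -
    have "cis (- t) * (of_real p + \<i> * of_real s) \<in> line t p" unfolding line_def by blast
    then have "Re (cis t' * (cis (- t) * (of_real p + \<i> * of_real s))) = p'"
      using assms by (simp add: mem_line_iff)
    then show ?thesis by (simp add: mult.assoc[symmetric] cis_mult)
  qed
  have "sin (t' - t) = 0" using eq[of 0] eq[of 1] by simp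
  then have "cos (t' - t) = 1 \<or> cos (t' - t) = - 1" "cos t' = cos (t' - t) * cos t"
    using sin_zero_abs_cos_one[of "t' - t"] cos_add[of "t' - t" t] by auto
  then show ?thesis using eq[of 0] by auto
qed

text \<open>The condition is independent of the representation of the line, since the continuant is
  even or odd in \<open>p\<close>; \<open>Arg\<close> supplies an angle in the prescribed
  interval.\<close>

lemma line_in_kippenhahn_lines_iff:
  assumes "A \<in> reciprocal_matrices n"
    and "\<And>j. \<xi> j = (cmod (A $$ (j - 1, j)) - cmod (A $$ (j, j - 1)))\<^sup>2 / 4"
  shows "line t p \<in> kippenhahn_lines A \<longleftrightarrow> continuant (\<lambda>j. \<xi> j + (cos t)\<^sup>2) p n = 0"
proof -
  have poly: "kippenhahn_poly A (of_real p) t = 0 \<longleftrightarrow> continuant (\<lambda>j. \<xi> j + (cos t)\<^sup>2) p n = 0"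
    for p t
    by (subst kippenhahn_poly_continuant[OF assms]) auto
  show ?thesis
  proof
    assume "line t p \<in> kippenhahn_lines A"
    then obtain t' p' where *: "line t p = line t' p'" "kippenhahn_poly A (of_real p') t' = 0"
      unfolding kippenhahn_lines_def by blast
    show "continuant (\<lambda>j. \<xi> j + (cos t)\<^sup>2) p n = 0"
      using line_eqD[OF *(1)] *(2) by (auto simp: poly continuant_eq_0_uminus)
  next
    assume *: "continuant (\<lambda>j. \<xi> j + (cos t)\<^sup>2) p n = 0"
    define t' where "t' = Arg (cis t)"
    have "cis t' = cis t" by (simp add: t'_def cis_Arg sgn_eq)
    then have "line t p = line t' p" "cos t = cos t'"
      by (auto simp: mem_line_iff complex_eq_iff)
    moreover have "- pi < t'" "t' \<le> pi" using Arg_bounded by (auto simp: t'_def)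
    ultimately show "line t p \<in> kippenhahn_lines A"
      using * poly[of p t'] unfolding kippenhahn_lines_def by auto
  qed
qed

text \<open>Division of the line equation by \<open>cos t\<close> makes the condition polynomial in
  \<open>tan t\<close>.\<close>

lemma continuant_slope:
  assumes "cos t \<noteq> 0"
  shows "continuant (\<lambda>j. \<xi> j + (cos t)\<^sup>2) (cos t * w) n
    = cos t ^ n * continuant (\<lambda>j. 1 + \<xi> j * (1 + (tan t)\<^sup>2)) w n"
proof -
  have "(cos t)\<^sup>2 * (1 + (tan t)\<^sup>2) = 1"
    using assms by (simp add: tan_def power_divide distrib_left)
  moreover have "(cos t)\<^sup>2 * (1 + x * S) = x * ((cos t)\<^sup>2 * S) + (cos t)\<^sup>2" for x S
    by (simp add: algebra_simps)
  ultimately have "(cos t)\<^sup>2 * (1 + x * (1 + (tan t)\<^sup>2)) = x + (cos t)\<^sup>2" for x by simp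
  then show ?thesis by (simp flip: continuant_scale)
qed

text \<open>A root \<open>m = tan \<theta>\<close> of this polynomial is the slope \<open>dx/dy\<close> of a line of the family through \<open>z\<close>.
  Horizontal lines, i.e. \<open>cos \<theta> = 0\<close>, are not covered.\<close>

definition slope_poly :: "(nat \<Rightarrow> real) \<Rightarrow> nat \<Rightarrow> complex \<Rightarrow> real poly" where
  "slope_poly \<xi> n z = continuant (\<lambda>j. [:1 + \<xi> j, 0, \<xi> j:]) [:Re z, - Im z:] n"

lemma poly_slope_poly:
  "poly (slope_poly \<xi> n z) m = continuant (\<lambda>j. 1 + \<xi> j * (1 + m\<^sup>2)) (Re z - m * Im z) n"
  by (simp add: slope_poly_def poly_continuant algebra_simps power2_eq_square)

lemma slope_poly_differentiable_coeffs:
  assumes "\<And>u. (\<lambda>u. Re (z u)) differentiable at u" "\<And>u. (\<lambda>u. Im (z u)) differentiable at u"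
  shows "differentiable_coeffs (\<lambda>u. slope_poly \<xi> n (z u))"
  unfolding slope_poly_def
proof (induction n rule: induct_nat_012)
  case (ge2 n)
  then show ?case unfolding continuant.simps
    by (intro differentiable_coeffs_diff differentiable_coeffs_mult differentiable_coeffs_pCons
        differentiable_coeffs_const differentiable_minus assms)
qed (auto intro!: differentiable_coeffs_pCons differentiable_coeffs_const assms differentiable_minus)

text \<open>By the definition of the envelope, a branch \<open>p\<close> and the offset
  \<open>Re (cis s * z)\<close> of the lines through \<open>z\<close> agree to first order at
  \<open>t\<close>. The continuant vanishes along \<open>p\<close>, hence to first order along these
  offsets, which makes \<open>tan t\<close> a double root.\<close>

lemma kippenhahn_curve_double_root:
  assumes A: "A \<in> reciprocal_matrices n"
    and \<xi>: "\<And>j. \<xi> j = (cmod (A $$ (j - 1, j)) - cmod (A $$ (j, j - 1)))\<^sup>2 / 4"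
    and z: "z \<in> kippenhahn_curve A"
  shows "\<exists>t. continuant (\<lambda>j. \<xi> j + (cos t)\<^sup>2) (Re (cis t * z)) n = 0 \<and>
    (cos t \<noteq> 0 \<longrightarrow> poly (slope_poly \<xi> n z) (tan t) = 0 \<and>
      poly (pderiv (slope_poly \<xi> n z)) (tan t) = 0)"
proof -
  obtain p t where ev: "\<forall>\<^sub>F s in nhds t. line s (p s) \<in> kippenhahn_lines A"
    and p: "Re (cis t * z) - p t = 0"
    and d: "((\<lambda>s. Re (cis s * z) - p s) has_real_derivative 0) (at t)"
    using z unfolding kippenhahn_curve_def envelope_def by blast
  let ?g = "\<lambda>s. Re (cis s * z)"
  define h where "h s = continuant (\<lambda>j. \<xi> j + (cos s)\<^sup>2) (?g s) n" for s
  have "((\<lambda>s. cos s * Re z - sin s * Im z) has_real_derivative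
      - sin t * Re z - cos t * Im z) (at t)"
    by (auto intro!: derivative_eq_intros)
  then obtain e where g: "(?g has_real_derivative e) (at t)" by simp
  have f: "(p has_real_derivative e) (at t)"
    using DERIV_diff[OF g d] by simp
  have "\<exists>e. ((\<lambda>s. continuant (\<lambda>j. \<xi> j + (cos s)\<^sup>2) (p s) n) has_real_derivative e) (at t) \<and>
    (h has_real_derivative e) (at t)"
    unfolding h_def
  proof (intro continuant_tangent[OF f g])
    have "((\<lambda>s. \<xi> j + (cos s)\<^sup>2) has_real_derivative - 2 * cos t * sin t) (at t)" for j
      by (auto intro!: derivative_eq_intros)
    then show "(\<lambda>s. \<xi> j + (cos s)\<^sup>2) differentiable at t" for j
      using real_differentiable_def by blast
  qed (use p in simp)
  then obtain e' where e': "((\<lambda>s. continuant (\<lambda>j. \<xi> j + (cos s)\<^sup>2) (p s) n) has_real_derivative e') (at t)"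
    "(h has_real_derivative e') (at t)" by blast
  have ev0: "\<forall>\<^sub>F s in nhds t. continuant (\<lambda>j. \<xi> j + (cos s)\<^sup>2) (p s) n = 0"
    using ev by (simp add: line_in_kippenhahn_lines_iff[OF A \<xi>])
  have "((\<lambda>s. 0) has_real_derivative e') (at t)"
    using e'(1) DERIV_cong_ev[OF refl ev0 refl] by simp
  then have "e' = 0" using DERIV_unique DERIV_const by blast
  with e'(2) have h': "(h has_real_derivative 0) (at t)" by simp
  have h0: "h t = 0"
    using eventually_nhds_x_imp_x[OF ev0] p by (simp add: h_def)
  let ?P = "slope_poly \<xi> n z"
  have h_eq: "h s = cos s ^ n * poly ?P (tan s)" if "cos s \<noteq> 0" for s
  proof -
    have "?g s = cos s * (Re z - tan s * Im z)"
      using that by (simp add: tan_def field_simps)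
    then show ?thesis
      using continuant_slope[OF that] by (simp add: h_def poly_slope_poly)
  qed
  have "poly (pderiv ?P) (tan t) = 0" if c: "cos t \<noteq> 0"
  proof -
    have "open {s::real. cos s \<noteq> 0}"
      by (intro open_Collect_neq continuous_intros)
    then have "\<forall>\<^sub>F s in nhds t. cos s \<noteq> 0"
      using c eventually_nhds_in_open by fastforce
    then have "\<forall>\<^sub>F s in nhds t. poly ?P (tan s) = h s / cos s ^ n"
      by eventually_elim (simp add: h_eq)
    moreover have "((\<lambda>s. h s / cos s ^ n) has_real_derivative 0) (at t)"
      using c h0 by (auto intro!: derivative_eq_intros h')
    ultimately have "((\<lambda>s. poly ?P (tan s)) has_real_derivative 0) (at t)"
      by (subst DERIV_cong_ev[OF refl _ refl])
    moreover have "((\<lambda>s. poly ?P (tan s)) has_real_derivative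
        poly (pderiv ?P) (tan t) * inverse ((cos t)\<^sup>2)) (at t)"
      by (rule DERIV_chain2[OF poly_DERIV DERIV_tan[OF c]])
    ultimately show ?thesis using DERIV_unique c by fastforce
  qed
  moreover have "poly ?P (tan t) = 0" if "cos t \<noteq> 0"
    using h_eq[OF that] h0 that by simp
  ultimately show ?thesis using h0 unfolding h_def by blast
qed

text \<open>The line \<open>Re z - m * Im z = w\<close> touches the ellipse with semiaxes
  \<open>a\<close> and \<open>b\<close> if and only if
  \<open>w\<^sup>2 = a\<^sup>2 + b\<^sup>2 * m\<^sup>2\<close>. If only finitely many such
  \<open>m\<close> belonged to the family, their points of contact could be removed, and
  \<open>double_roots_stationary\<close> would still produce a tangent in the family.\<close>

lemma ellipse_in_kippenhahn_curve_imp_tangents: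
  assumes A: "A \<in> reciprocal_matrices (Suc n)"
    and \<xi>: "\<And>j. \<xi> j = (cmod (A $$ (j - 1, j)) - cmod (A $$ (j, j - 1)))\<^sup>2 / 4"
    and ab: "a > 0" "b > 0"
    and curve: "\<And>u. Complex (a * cos u) (b * sin u) \<in> kippenhahn_curve A"
  shows "infinite {m. continuant (\<lambda>j. 1 + \<xi> j * (1 + m\<^sup>2)) (sqrt (a\<^sup>2 + b\<^sup>2 * m\<^sup>2)) (Suc n) = 0}"
    (is "infinite ?M")
proof
  assume fin: "finite ?M"
  \<comment> \<open>On this open quarter of the ellipse, \<open>sin\<close>, \<open>cos\<close> and
    \<open>tan\<close> are injective, so finite sets have finite preimages.\<close>
  define I where "I = {0<..<pi/2}"
  let ?z = "\<lambda>u. Complex (a * cos u) (b * sin u)"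
  text \<open>The three exceptional sets: points on a horizontal line of the family, points on a vertical
    one (so that \<open>slope_poly\<close> does not vanish identically at the others), and points where the
    tangent of the ellipse belongs to the family.\<close>
  define S where "S = I - ((\<lambda>u. b * sin u) -` {x. continuant \<xi> x (Suc n) = 0} \<inter> I)
    - ((\<lambda>u. a * cos u) -` {x. continuant (\<lambda>j. 1 + \<xi> j) x (Suc n) = 0} \<inter> I)
    - ((\<lambda>u. - (a / b * tan u)) -` ?M \<inter> I)"
  have inj: "inj_on (\<lambda>u. b * sin u) I" "inj_on (\<lambda>u. a * cos u) I" "inj_on (\<lambda>u. - (a / b * tan u)) I"
  proof -
    have "sin u < sin v" "cos v < cos u" "tan u < tan v" if "u \<in> I" "v \<in> I" "u < v" for u v
      using that sin_monotone_2pi[of u v] cos_monotone_0_pi[of u v] tan_monotone[of u v]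
      by (auto simp: I_def)
    then have "sin u \<noteq> sin v \<and> cos u \<noteq> cos v \<and> tan u \<noteq> tan v" if "u \<in> I" "v \<in> I" "u \<noteq> v" for u v
      using that by (metis less_irrefl linorder_neqE_linordered_idom)
    then show "inj_on (\<lambda>u. b * sin u) I" "inj_on (\<lambda>u. a * cos u) I" "inj_on (\<lambda>u. - (a / b * tan u)) I"
      using ab by (auto simp: inj_on_def)
  qed
  have "uncountable I" by (simp add: I_def uncountable_open_interval)
  then have S: "uncountable S"
    unfolding S_def using inj fin
    by (intro uncountable_minus_countable countable_finite finite_vimage_IntI finite_continuant_roots)
  have "\<exists>m. poly (slope_poly \<xi> (Suc n) (?z u)) m = 0 \<and>
      poly (pderiv (slope_poly \<xi> (Suc n) (?z u))) m = 0" if u: "u \<in> S" for u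
  proof -
    obtain t where t: "continuant (\<lambda>j. \<xi> j + (cos t)\<^sup>2) (Re (cis t * ?z u)) (Suc n) = 0"
      "cos t \<noteq> 0 \<Longrightarrow> poly (slope_poly \<xi> (Suc n) (?z u)) (tan t) = 0 \<and>
      poly (pderiv (slope_poly \<xi> (Suc n) (?z u))) (tan t) = 0"
      using kippenhahn_curve_double_root[OF A \<xi> curve] by blast
    have "cos t \<noteq> 0"
    proof
      assume c: "cos t = 0"
      then have "sin t = 1 \<or> sin t = - 1" using sin_cos_squared_add[of t] by (simp add: power2_eq_1_iff)
      then have "continuant \<xi> (b * sin u) (Suc n) = 0"
        using t(1) c by (auto simp: continuant_eq_0_uminus)
      with u show False by (auto simp: S_def)
    qed
    with t(2) show ?thesis by blast
  qed
  then obtain m where m: "\<And>u. u \<in> S \<Longrightarrow> poly (slope_poly \<xi> (Suc n) (?z u)) (m u) = 0"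
    "\<And>u. u \<in> S \<Longrightarrow> poly (pderiv (slope_poly \<xi> (Suc n) (?z u))) (m u) = 0"
    by metis
  have nz: "slope_poly \<xi> (Suc n) (?z u) \<noteq> 0" if u: "u \<in> S" for u
  proof
    assume "slope_poly \<xi> (Suc n) (?z u) = 0"
    then have "poly (slope_poly \<xi> (Suc n) (?z u)) 0 = 0" by simp
    with u show False by (auto simp: poly_slope_poly S_def)
  qed
  have "\<exists>u\<in>S. ((\<lambda>v. poly (slope_poly \<xi> (Suc n) (?z v)) (m u)) has_real_derivative 0) (at u)"
    by (rule double_roots_stationary[OF slope_poly_differentiable_coeffs S nz])
      (auto simp: m real_differentiable_def intro: DERIV_cmult DERIV_sin DERIV_cos)
  then obtain u where u: "u \<in> S"
    "((\<lambda>v. poly (slope_poly \<xi> (Suc n) (?z v)) (m u)) has_real_derivative 0) (at u)" by blast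
  define w where "w v = a * cos v - m u * (b * sin v)" for v
  let ?q = "\<lambda>j. 1 + \<xi> j * (1 + (m u)\<^sup>2)"
  have root: "continuant ?q (w u) (Suc n) = 0"
    using m(1)[OF u(1)] by (simp add: poly_slope_poly w_def)
  have "?q j > 0" for j by (simp add: \<xi> add_pos_nonneg)
  then obtain d where d: "((\<lambda>x. continuant ?q x (Suc n)) has_real_derivative d) (at (w u))" "d \<noteq> 0"
    using continuant_simple_root[OF _ root] by blast
  have w': "(w has_real_derivative - a * sin u - m u * (b * cos u)) (at u)"
    unfolding w_def by (auto intro!: derivative_eq_intros)
  \<comment> \<open>The slope \<open>m u\<close> is frozen and the root \<open>w u\<close> is
    simple. Hence \<open>w\<close> is stationary at \<open>u\<close>, i.e. the line of slope
    \<open>m u\<close> has the direction of the ellipse at \<open>?z u\<close>.\<close>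
  have "((\<lambda>v. continuant ?q (w v) (Suc n)) has_real_derivative d * (- a * sin u - m u * (b * cos u))) (at u)"
    by (rule DERIV_chain2[OF d(1) w'])
  moreover have "((\<lambda>v. continuant ?q (w v) (Suc n)) has_real_derivative 0) (at u)"
    using u(2) by (simp add: poly_slope_poly w_def)
  ultimately have "d * (- a * sin u - m u * (b * cos u)) = 0" by (rule DERIV_unique)
  then have mu: "m u * (b * cos u) = - a * sin u" using d(2) by simp
  have "cos u > 0" using u(1) by (auto simp: S_def I_def intro!: cos_gt_zero)
  then have m_eq: "m u = - (a / b * tan u)" using mu ab by (simp add: tan_def field_simps)
  have w_eq: "w u = a / cos u"
  proof -
    have "w u * cos u = a * (cos u)\<^sup>2 - sin u * (m u * (b * cos u))"
      by (simp add: w_def algebra_simps power2_eq_square)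
    also have "\<dots> = a * ((cos u)\<^sup>2 + (sin u)\<^sup>2)"
    proof -
      have "a * c - x * (- a * x) = a * (c + x\<^sup>2)" for c x :: real
        by (simp add: algebra_simps power2_eq_square)
      then show ?thesis unfolding mu .
    qed
    finally show ?thesis using \<open>cos u > 0\<close> by (simp add: field_simps)
  qed
  have "(w u)\<^sup>2 = a\<^sup>2 * ((cos u)\<^sup>2 + (sin u)\<^sup>2) / (cos u)\<^sup>2"
    by (simp add: w_eq power_divide)
  also have "\<dots> = a\<^sup>2 + b\<^sup>2 * (m u)\<^sup>2"
  proof -
    have "a\<^sup>2 * (c\<^sup>2 + x\<^sup>2) / c\<^sup>2 = a\<^sup>2 + b\<^sup>2 * (- (a / b * (x / c)))\<^sup>2" if "c > 0" for c x
      using that ab by (simp add: field_simps)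
    then show ?thesis using \<open>cos u > 0\<close> by (simp only: m_eq tan_def)
  qed
  finally have "w u = sqrt (a\<^sup>2 + b\<^sup>2 * (m u)\<^sup>2)"
    using ab \<open>cos u > 0\<close> by (metis w_eq divide_pos_pos less_imp_le real_sqrt_unique)
  with root have "m u \<in> ?M" by simp
  then show False using u(1) m_eq by (auto simp: S_def)
qed

subsection \<open>Ellipses with foci \<open>\<plusminus>\<surd>2\<close>\<close>

text \<open>The coefficients, as a polynomial in \<open>\<tau> = (cos \<theta>)\<^sup>2\<close>, of the Kippenhahn polynomial restricted to
  the tangents of the ellipse with foci \<open>\<plusminus>\<surd>2\<close> and squared minor semiaxis \<open>s\<close>, divided by \<open>- p\<close>;
  see \<open>continuant_confocal\<close>. The coefficient of \<open>\<tau>\<^sup>3\<close> vanishes because \<open>\<plusminus>\<surd>2\<close> are eigenvalues of \<open>A\<close>.\<close>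

definition confocal0 :: "(nat \<Rightarrow> real) \<Rightarrow> real \<Rightarrow> real" where
  "confocal0 \<xi> s = s ^ 3 - (\<xi> 1 + \<xi> 2 + \<xi> 3 + \<xi> 4 + \<xi> 5 + \<xi> 6) * s\<^sup>2
    + (\<xi> 1 * \<xi> 3 + \<xi> 1 * \<xi> 4 + \<xi> 1 * \<xi> 5 + \<xi> 1 * \<xi> 6 + \<xi> 2 * \<xi> 4 + \<xi> 2 * \<xi> 5 + \<xi> 2 * \<xi> 6
       + \<xi> 3 * \<xi> 5 + \<xi> 3 * \<xi> 6 + \<xi> 4 * \<xi> 6) * s
    - (\<xi> 1 * \<xi> 3 * \<xi> 5 + \<xi> 1 * \<xi> 3 * \<xi> 6 + \<xi> 1 * \<xi> 4 * \<xi> 6 + \<xi> 2 * \<xi> 4 * \<xi> 6)"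

definition confocal1 :: "(nat \<Rightarrow> real) \<Rightarrow> real \<Rightarrow> real" where
  "confocal1 \<xi> s = (\<xi> 2 + \<xi> 3) * (\<xi> 5 + \<xi> 6) + (\<xi> 4 + \<xi> 5) * (\<xi> 1 + \<xi> 2)
    - (\<xi> 2 + \<xi> 3 + \<xi> 4 + \<xi> 5) * s"

definition confocal2 :: "(nat \<Rightarrow> real) \<Rightarrow> real \<Rightarrow> real" where
  "confocal2 \<xi> s = \<xi> 1 + \<xi> 2 + \<xi> 5 + \<xi> 6 - 2 * s"

lemma continuant_confocal:
  assumes "p\<^sup>2 = s + 2 * \<tau>"
  shows "continuant (\<lambda>j. \<xi> j + \<tau>) p 7
    = p * (confocal0 \<xi> s + confocal1 \<xi> s * \<tau> + confocal2 \<xi> s * \<tau>\<^sup>2)"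
proof -
  have "p ^ 6 = (s + 2 * \<tau>) ^ 3" "p ^ 4 = (s + 2 * \<tau>)\<^sup>2"
    unfolding assms[symmetric] by (simp_all flip: power_mult)
  then show ?thesis
    unfolding continuant_7 assms confocal0_def confocal1_def confocal2_def
    by (simp add: power2_eq_square power3_eq_cube algebra_simps)
qed

text \<open>Here \<open>p\<close> is not the trivial root 0 and can be cancelled; multiplication by
  the square of \<open>1 + (tan t)\<^sup>2\<close> removes the cosines.\<close>

lemma continuant_confocal_root:
  assumes "continuant (\<lambda>j. \<xi> j + (cos t)\<^sup>2) p 7 = 0" "p\<^sup>2 = s + 2 * (cos t)\<^sup>2"
    and "s \<ge> 0" "cos t \<noteq> 0"
  shows "confocal0 \<xi> s * (1 + (tan t)\<^sup>2)\<^sup>2 + confocal1 \<xi> s * (1 + (tan t)\<^sup>2) + confocal2 \<xi> s = 0"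
proof -
  define S where "S = 1 + (tan t)\<^sup>2"
  have S: "(cos t)\<^sup>2 * S = 1"
    using assms(4) by (simp add: S_def tan_def power_divide distrib_left)
  have "s + 2 * (cos t)\<^sup>2 > 0" using assms(3,4) by (simp add: add_nonneg_pos)
  then have "p \<noteq> 0" using assms(2) by auto
  then have "confocal0 \<xi> s + confocal1 \<xi> s * (cos t)\<^sup>2 + confocal2 \<xi> s * ((cos t)\<^sup>2)\<^sup>2 = 0"
    using assms(1) by (simp add: continuant_confocal[OF assms(2)])
  then have "0 = (confocal0 \<xi> s + confocal1 \<xi> s * (cos t)\<^sup>2 + confocal2 \<xi> s * ((cos t)\<^sup>2)\<^sup>2) * S\<^sup>2"
    by simp
  also have "\<dots> = confocal0 \<xi> s * S\<^sup>2 + confocal1 \<xi> s * S * ((cos t)\<^sup>2 * S)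
      + confocal2 \<xi> s * ((cos t)\<^sup>2 * S)\<^sup>2"
    by (simp add: power2_eq_square algebra_simps)
  finally show ?thesis by (simp add: S flip: S_def)
qed

text \<open>The linear equation \<open>confocal2 \<xi> s = 0\<close> fixes
  \<open>s = (?u + ?v) / 2\<close>. For this \<open>s\<close>, \<open>confocal1\<close> is a
  multiple of the product of \<open>?v - ?u\<close> and the difference of the sides of the last
  equation. When that difference is 0, \<open>confocal0\<close> is a multiple of
  \<open>(?u - ?v) * ?Q\<close>; when \<open>?u = ?v\<close>, it vanishes as well.\<close>

lemma confocal_iff:
  "(\<exists>s. confocal0 \<xi> s = 0 \<and> confocal1 \<xi> s = 0 \<and> confocal2 \<xi> s = 0) \<longleftrightarrow>
    \<xi> 1 + \<xi> 2 = \<xi> 5 + \<xi> 6 \<or>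
    ((\<xi> 1)\<^sup>2 + 2 * \<xi> 2 * \<xi> 1 - 2 * \<xi> 3 * \<xi> 1 - 2 * \<xi> 4 * \<xi> 1 + (\<xi> 2)\<^sup>2 - (\<xi> 5)\<^sup>2 - (\<xi> 6)\<^sup>2
       + 2 * \<xi> 2 * \<xi> 3 - 2 * \<xi> 2 * \<xi> 4 + 2 * \<xi> 3 * \<xi> 5 - 2 * \<xi> 4 * \<xi> 5
       + 2 * \<xi> 3 * \<xi> 6 + 2 * \<xi> 4 * \<xi> 6 - 2 * \<xi> 5 * \<xi> 6 = 0 \<and>
     \<xi> 2 + \<xi> 3 = \<xi> 4 + \<xi> 5)"
  (is "?lhs \<longleftrightarrow> ?u = ?v \<or> (?Q = 0 \<and> _ = _)")
proof -
  define s where "s = (?u + ?v) / 2"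
  have s: "confocal2 \<xi> t = 0 \<longleftrightarrow> t = s" for t
    by (auto simp: confocal2_def s_def)
  have one: "2 * confocal1 \<xi> s = (?v - ?u) * (\<xi> 2 + \<xi> 3 - (\<xi> 4 + \<xi> 5))"
    by (simp add: confocal1_def s_def algebra_simps)
  have zero: "8 * confocal0 \<xi> s = - (?u - ?v) * ?Q" if "\<xi> 2 + \<xi> 3 = \<xi> 4 + \<xi> 5"
  proof -
    have e: "\<xi> 5 = \<xi> 2 + \<xi> 3 - \<xi> 4" using that by simp
    show ?thesis unfolding confocal0_def s_def e
      by (simp add: power2_eq_square power3_eq_cube field_simps)
  qed
  have equal: "confocal0 \<xi> s = 0" if "?u = ?v"
  proof -
    have e: "\<xi> 1 = \<xi> 5 + \<xi> 6 - \<xi> 2" using that by simp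
    show ?thesis unfolding confocal0_def s_def e
      by (simp add: power2_eq_square power3_eq_cube field_simps)
  qed
  have "?lhs \<longleftrightarrow> confocal0 \<xi> s = 0 \<and> confocal1 \<xi> s = 0" using s by auto
  also have "\<dots> \<longleftrightarrow> ?u = ?v \<or> (?Q = 0 \<and> \<xi> 2 + \<xi> 3 = \<xi> 4 + \<xi> 5)"
  proof (cases "?u = ?v")
    case True
    then show ?thesis using equal one by simp
  next
    case False
    have "confocal1 \<xi> s = 0 \<longleftrightarrow> \<xi> 2 + \<xi> 3 = \<xi> 4 + \<xi> 5"
      using one False by auto
    moreover have "confocal0 \<xi> s = 0 \<longleftrightarrow> ?Q = 0" if "\<xi> 2 + \<xi> 3 = \<xi> 4 + \<xi> 5"
      using zero[OF that] False by auto
    ultimately show ?thesis using False by blast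
  qed
  finally show ?thesis .
qed

text \<open>For negative \<open>s\<close> all terms of the cubic have the same sign. The result
  admits \<open>s\<close> as a squared semiaxis.\<close>

lemma confocal0_root_nonneg:
  assumes "\<And>j. \<xi> j \<ge> 0" "confocal0 \<xi> s = 0"
  shows "s \<ge> 0"
proof (rule ccontr)
  assume "\<not> s \<ge> 0"
  then have s: "s < 0" by simp
  have le: "x * s \<le> 0" if "x \<ge> 0" for x using s that by (simp add: mult_nonneg_nonpos)
  have "s ^ 3 < 0" using s by (simp add: power_less_zero_eq)
  moreover have "(\<xi> 1 + \<xi> 2 + \<xi> 3 + \<xi> 4 + \<xi> 5 + \<xi> 6) * s\<^sup>2 \<ge> 0"
    using assms(1) by (intro mult_nonneg_nonneg add_nonneg_nonneg) auto
  moreover have "(\<xi> 1 * \<xi> 3 + \<xi> 1 * \<xi> 4 + \<xi> 1 * \<xi> 5 + \<xi> 1 * \<xi> 6 + \<xi> 2 * \<xi> 4 + \<xi> 2 * \<xi> 5 + \<xi> 2 * \<xi> 6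
       + \<xi> 3 * \<xi> 5 + \<xi> 3 * \<xi> 6 + \<xi> 4 * \<xi> 6) * s \<le> 0"
    using assms(1) by (intro le add_nonneg_nonneg mult_nonneg_nonneg)
  moreover have "\<xi> 1 * \<xi> 3 * \<xi> 5 + \<xi> 1 * \<xi> 3 * \<xi> 6 + \<xi> 1 * \<xi> 4 * \<xi> 6 + \<xi> 2 * \<xi> 4 * \<xi> 6 \<ge> 0"
    using assms(1) by (intro add_nonneg_nonneg mult_nonneg_nonneg)
  ultimately show False using assms(2) unfolding confocal0_def by linarith
qed

text \<open>The expression is a polynomial in \<open>m\<close> of degree at most 4.\<close>

lemma confocal_eq_0:
  assumes "infinite {m. confocal0 \<xi> s * (1 + m\<^sup>2)\<^sup>2 + confocal1 \<xi> s * (1 + m\<^sup>2) + confocal2 \<xi> s = 0}"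
  shows "confocal0 \<xi> s = 0 \<and> confocal1 \<xi> s = 0 \<and> confocal2 \<xi> s = 0"
proof -
  let ?p = "[:confocal0 \<xi> s + confocal1 \<xi> s + confocal2 \<xi> s, 0,
    2 * confocal0 \<xi> s + confocal1 \<xi> s, 0, confocal0 \<xi> s:]"
  have p: "poly ?p m = confocal0 \<xi> s * (1 + m\<^sup>2)\<^sup>2 + confocal1 \<xi> s * (1 + m\<^sup>2) + confocal2 \<xi> s" for m
    by (simp add: algebra_simps power2_eq_square)
  have "infinite {m. poly ?p m = 0}" unfolding p by (rule assms)
  then have "?p = 0" using poly_roots_finite by blast
  then show ?thesis by simp
qed

text \<open>Subtracting the squared focal distances gives
  \<open>a * d = a\<^sup>2 - c * Re z\<close>, which is squared once more.\<close>

lemma ellipse_equation: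
  assumes "z \<in> ellipse (of_real c) (- of_real c) a"
  shows "(a\<^sup>2 - c\<^sup>2) * (Re z)\<^sup>2 + a\<^sup>2 * (Im z)\<^sup>2 = a\<^sup>2 * (a\<^sup>2 - c\<^sup>2)"
proof -
  define d e where "d = dist z (of_real c)" and "e = dist z (- of_real c)"
  have de: "d\<^sup>2 = (Re z - c)\<^sup>2 + (Im z)\<^sup>2" "e\<^sup>2 = (Re z + c)\<^sup>2 + (Im z)\<^sup>2"
    by (simp_all add: d_def e_def dist_norm cmod_power2)
  have sum: "d + e = 2 * a" using assms by (simp add: ellipse_def d_def e_def)
  then have e: "2 * a - d = e" by simp
  have "d\<^sup>2 - (2 * a - d)\<^sup>2 = - 4 * c * Re z"
    unfolding e de by (simp add: power2_eq_square algebra_simps)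
  then have "a * d = a\<^sup>2 - c * Re z" by (simp add: power2_eq_square algebra_simps)
  then have "a\<^sup>2 * d\<^sup>2 = (a\<^sup>2 - c * Re z)\<^sup>2" by (simp flip: power_mult_distrib)
  then show ?thesis unfolding de(1) by (simp add: power2_eq_square algebra_simps)
qed

text \<open>The focal distances are \<open>a - c * cos u\<close> and
  \<open>a + c * cos u\<close>.\<close>

lemma in_ellipse:
  assumes "0 \<le> c" "c \<le> a" "b\<^sup>2 = a\<^sup>2 - c\<^sup>2"
  shows "Complex (a * cos u) (b * sin u) \<in> ellipse (of_real c) (- of_real c) a"
proof -
  have "\<bar>c * cos u\<bar> \<le> c * 1"
    unfolding abs_mult using assms(1) by (intro mult_mono) auto
  then have le: "\<bar>c * cos u\<bar> \<le> a" using assms(2) by simp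
  have "(b * sin u)\<^sup>2 = (a\<^sup>2 - c\<^sup>2) * (1 - (cos u)\<^sup>2)"
    by (simp add: power_mult_distrib assms(3) sin_squared_eq)
  then have sq: "(a * cos u - x)\<^sup>2 + (b * sin u)\<^sup>2 = (a - x * cos u)\<^sup>2" if "x = c \<or> x = - c" for x
    using that by (auto simp: power2_eq_square algebra_simps)
  have "dist (Complex (a * cos u) (b * sin u)) (of_real x) = a - x * cos u" if "x = c \<or> x = - c" for x
    using sq[OF that] le that by (auto simp: dist_norm cmod_def)
  from this[of c] this[of "- c"] show ?thesis by (simp add: ellipse_def)
qed

text \<open>The squared semiaxes are \<open>s + 2\<close> and \<open>s\<close>, so the offset of a
  tangent is the square root of (s + 2) cos^2 t + s sin^2 t. The vanishing derivative makes
  \<open>z\<close> the characteristic point of its tangent.\<close>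

lemma ellipse_tangent:
  fixes s :: real
  assumes s: "s > 0" and z: "s * (Re z)\<^sup>2 + (s + 2) * (Im z)\<^sup>2 = s * (s + 2)"
  shows "\<exists>t. Re (cis t * z) - sqrt (s + 2 * (cos t)\<^sup>2) = 0 \<and>
    ((\<lambda>u. Re (cis u * z) - sqrt (s + 2 * (cos u)\<^sup>2)) has_real_derivative 0) (at t)"
proof -
  \<comment> \<open>The vector \<open>(x, y)\<close> is normal to the ellipse at \<open>z\<close>.
    Its conjugate gives the angle, because \<open>Re (cis t * z)\<close> is the inner product of
    \<open>z\<close> with the conjugate of \<open>cis t\<close>; the tangent has distance
    \<open>1 / r\<close> from the origin.\<close>
  define x y where "x = Re z / (s + 2)" and "y = Im z / s"
  define r where "r = cmod (Complex x (- y))"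
  define t where "t = Arg (Complex x (- y))"
  have X: "Re z = (s + 2) * x" and Y: "Im z = s * y" using s by (simp_all add: x_def y_def)
  have one: "(s + 2) * x\<^sup>2 + s * y\<^sup>2 = 1"
  proof -
    have "s * (s + 2) * ((s + 2) * x\<^sup>2 + s * y\<^sup>2) = s * (s + 2) * 1"
      using z unfolding X Y by (simp add: power2_eq_square algebra_simps)
    then show ?thesis using s by (metis mult_left_cancel add_pos_pos mult_eq_0_iff less_irrefl zero_less_numeral)
  qed
  then have "Complex x (- y) \<noteq> 0" by (auto simp: complex_eq_iff)
  then have r: "r > 0" and "cis t = Complex x (- y) / of_real r"
    by (simp_all add: r_def t_def cis_Arg sgn_eq)
  then have c: "cos t = x / r" "sin t = - (y / r)"
    by (simp_all add: complex_eq_iff)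
  have r2: "r\<^sup>2 = x\<^sup>2 + y\<^sup>2" by (simp add: r_def cmod_power2)
  have "s + 2 * (cos t)\<^sup>2 = (1 / r)\<^sup>2"
  proof -
    have "s * r\<^sup>2 + 2 * x\<^sup>2 = 1" using one by (simp add: r2 algebra_simps)
    then show ?thesis using r by (simp add: c field_simps)
  qed
  then have p: "sqrt (s + 2 * (cos t)\<^sup>2) = 1 / r" using r by (simp only: real_sqrt_abs) simp
  have "Re (cis t * z) = ((s + 2) * x\<^sup>2 + s * y\<^sup>2) / r"
    by (simp add: c X Y power2_eq_square add_divide_distrib mult_ac)
  then have on: "Re (cis t * z) - sqrt (s + 2 * (cos t)\<^sup>2) = 0" by (simp add: p one)
  have pos: "s + 2 * (cos t)\<^sup>2 > 0" using s by (simp add: add_pos_nonneg)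
  have "((\<lambda>u. cos u * Re z - sin u * Im z - sqrt (s + 2 * (cos u)\<^sup>2)) has_real_derivative
      - sin t * Re z - cos t * Im z + 2 * cos t * sin t / sqrt (s + 2 * (cos t)\<^sup>2)) (at t)"
    using pos by (auto intro!: derivative_eq_intros simp: field_simps)
  moreover have "- sin t * Re z - cos t * Im z + 2 * cos t * sin t / sqrt (s + 2 * (cos t)\<^sup>2) = 0"
    unfolding p unfolding c X Y using r by (simp add: field_simps)
  ultimately have "((\<lambda>u. Re (cis u * z) - sqrt (s + 2 * (cos u)\<^sup>2)) has_real_derivative 0) (at t)"
    by simp
  with on show ?thesis by blast
qed

theorem corollary1:
  fixes A :: "complex mat" and \<xi> :: "nat \<Rightarrow> real"
  assumes "A \<in> reciprocal_matrices 7"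
    and "\<And>j. j \<in> {1..6} \<Longrightarrow> \<xi> j = (cmod (A $$ (j - 1, j)) - cmod (A $$ (j, j - 1)))\<^sup>2 / 4"
  shows "kippenhahn_curve_contains_ellipse A (complex_of_real (sqrt 2)) (- complex_of_real (sqrt 2)) \<longleftrightarrow>
    \<xi> 1 + \<xi> 2 = \<xi> 5 + \<xi> 6 \<or>
    ((\<xi> 1)\<^sup>2 + 2 * \<xi> 2 * \<xi> 1 - 2 * \<xi> 3 * \<xi> 1 - 2 * \<xi> 4 * \<xi> 1 + (\<xi> 2)\<^sup>2 - (\<xi> 5)\<^sup>2 - (\<xi> 6)\<^sup>2
       + 2 * \<xi> 2 * \<xi> 3 - 2 * \<xi> 2 * \<xi> 4 + 2 * \<xi> 3 * \<xi> 5 - 2 * \<xi> 4 * \<xi> 5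
       + 2 * \<xi> 3 * \<xi> 6 + 2 * \<xi> 4 * \<xi> 6 - 2 * \<xi> 5 * \<xi> 6 = 0 \<and>
     \<xi> 2 + \<xi> 3 = \<xi> 4 + \<xi> 5)"
proof -
  \<comment> \<open>\<open>\<eta>\<close> follows the formula at every index, so that it is
    nonnegative throughout; on \<open>{1..6}\<close> it agrees with \<open>\<xi>\<close>.\<close>
  define \<eta> where "\<eta> j = (cmod (A $$ (j - 1, j)) - cmod (A $$ (j, j - 1)))\<^sup>2 / 4" for j
  have "\<eta> j \<ge> 0" for j by (simp add: \<eta>_def)
  note lines = line_in_kippenhahn_lines_iff[OF assms(1) \<eta>_def]
  let ?C = "\<lambda>s. confocal0 \<eta> s = 0 \<and> confocal1 \<eta> s = 0 \<and> confocal2 \<eta> s = 0"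
  have "kippenhahn_curve_contains_ellipse A (of_real (sqrt 2)) (- of_real (sqrt 2)) \<longleftrightarrow> (\<exists>s. ?C s)"
  proof
    assume "kippenhahn_curve_contains_ellipse A (of_real (sqrt 2)) (- of_real (sqrt 2))"
    then consider a where "dist (of_real (sqrt 2)) (- of_real (sqrt 2) :: complex) < 2 * a"
        "ellipse (of_real (sqrt 2)) (- of_real (sqrt 2)) a \<subseteq> kippenhahn_curve A"
      | "pencil (of_real (sqrt 2)) \<subseteq> kippenhahn_lines A"
      unfolding kippenhahn_curve_contains_ellipse_def by blast
    then show "\<exists>s. ?C s"
    proof cases
      case 1
      have "dist (of_real (sqrt 2)) (- of_real (sqrt 2) :: complex) = 2 * sqrt 2"
        by (simp add: dist_norm flip: of_real_add)
      with 1(1) have a: "sqrt 2 < a" by simp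
      then have "2 < a\<^sup>2" by (metis real_sqrt_less_iff real_sqrt_abs abs_of_pos less_trans real_sqrt_gt_zero zero_less_numeral)
      define b where "b = sqrt (a\<^sup>2 - 2)"
      have b: "b > 0" "b\<^sup>2 = a\<^sup>2 - (sqrt 2)\<^sup>2" using \<open>2 < a\<^sup>2\<close> by (simp_all add: b_def)
      have "a > 0" using a by (meson less_trans real_sqrt_gt_zero zero_less_numeral)
      have "\<And>u. Complex (a * cos u) (b * sin u) \<in> kippenhahn_curve A"
        using in_ellipse[of "sqrt 2" a b] 1(2) a b(2) by auto
      then have "infinite {m. continuant (\<lambda>j. 1 + \<eta> j * (1 + m\<^sup>2)) (sqrt (a\<^sup>2 + b\<^sup>2 * m\<^sup>2)) (Suc 6) = 0}"
        using assms(1) by (intro ellipse_in_kippenhahn_curve_imp_tangents[OF _ \<eta>_def \<open>a > 0\<close> b(1)]) simp_all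
      moreover have "confocal0 \<eta> (b\<^sup>2) * (1 + m\<^sup>2)\<^sup>2 + confocal1 \<eta> (b\<^sup>2) * (1 + m\<^sup>2) + confocal2 \<eta> (b\<^sup>2) = 0"
        if m: "continuant (\<lambda>j. 1 + \<eta> j * (1 + m\<^sup>2)) (sqrt (a\<^sup>2 + b\<^sup>2 * m\<^sup>2)) (Suc 6) = 0" for m
      proof -
        \<comment> \<open>The tangent of slope \<open>m\<close> is rewritten as
          \<open>line t p\<close>; then \<open>a\<^sup>2 = b\<^sup>2 + 2\<close> gives the confocal
          form with \<open>s = b\<^sup>2\<close>.\<close>
        define t where "t = arctan m"
        have t: "tan t = m" "cos t \<noteq> 0" by (simp_all add: t_def tan_arctan)
        define p where "p = cos t * sqrt (a\<^sup>2 + b\<^sup>2 * m\<^sup>2)"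
        have sec: "(cos t)\<^sup>2 * (1 + m\<^sup>2) = 1"
          using t(2) by (simp add: tan_def power_divide distrib_left flip: t(1))
        have "a\<^sup>2 = b\<^sup>2 + 2" using b(2) by simp
        then have "p\<^sup>2 = b\<^sup>2 * ((cos t)\<^sup>2 * (1 + m\<^sup>2)) + 2 * (cos t)\<^sup>2"
          by (simp add: p_def power_mult_distrib algebra_simps)
        then have "p\<^sup>2 = b\<^sup>2 + 2 * (cos t)\<^sup>2" by (simp add: sec)
        moreover have "continuant (\<lambda>j. \<eta> j + (cos t)\<^sup>2) p 7 = 0"
          using continuant_slope[OF t(2), of \<eta> "sqrt (a\<^sup>2 + b\<^sup>2 * m\<^sup>2)" 7] m t(1) by (simp add: p_def)
        ultimately show ?thesis
          using continuant_confocal_root[of \<eta> t p "b\<^sup>2"] t by simp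
      qed
      ultimately have "infinite {m. confocal0 \<eta> (b\<^sup>2) * (1 + m\<^sup>2)\<^sup>2 + confocal1 \<eta> (b\<^sup>2) * (1 + m\<^sup>2) + confocal2 \<eta> (b\<^sup>2) = 0}"
        by (meson Collect_mono infinite_super)
      then show ?thesis using confocal_eq_0 by blast
    next
      case 2
      \<comment> \<open>Lines through the focus have \<open>p = cos t * sqrt 2\<close>, which is the
        confocal form with \<open>s = 0\<close>.\<close>
      have "confocal0 \<eta> 0 * (1 + m\<^sup>2)\<^sup>2 + confocal1 \<eta> 0 * (1 + m\<^sup>2) + confocal2 \<eta> 0 = 0" for m
      proof -
        define t where "t = arctan m"
        have t: "tan t = m" "cos t \<noteq> 0" by (simp_all add: t_def tan_arctan)
        have "line t (Re (cis t * of_real (sqrt 2))) \<in> kippenhahn_lines A"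
          using 2 by (auto simp: pencil_def)
        then have "continuant (\<lambda>j. \<eta> j + (cos t)\<^sup>2) (cos t * sqrt 2) 7 = 0" by (simp add: lines)
        then show ?thesis
          using continuant_confocal_root[of \<eta> t "cos t * sqrt 2" 0] t by (simp add: power_mult_distrib)
      qed
      then have "{m. confocal0 \<eta> 0 * (1 + m\<^sup>2)\<^sup>2 + confocal1 \<eta> 0 * (1 + m\<^sup>2) + confocal2 \<eta> 0 = 0} = UNIV"
        by blast
      then show ?thesis using confocal_eq_0[of \<eta> 0] infinite_UNIV_char_0[where 'a = real] by metis
    qed
  next
    assume "\<exists>s. ?C s"
    then obtain s where s: "?C s" ..
    then have "s \<ge> 0" using confocal0_root_nonneg \<open>\<And>j. \<eta> j \<ge> 0\<close> by blast
    \<comment> \<open>Both signs of \<open>p\<close> are covered: for \<open>s > 0\<close> they give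
      the two parallel tangents, for \<open>s = 0\<close> the parallel lines through the two
      foci.\<close>
    have in_lines: "line t p \<in> kippenhahn_lines A" if "p\<^sup>2 = s + 2 * (cos t)\<^sup>2" for t p
      using continuant_confocal[OF that] s by (simp add: lines)
    show "kippenhahn_curve_contains_ellipse A (of_real (sqrt 2)) (- of_real (sqrt 2))"
    proof (cases "s = 0")
      case True
      then have "pencil (of_real (sqrt 2)) \<union> pencil (- of_real (sqrt 2)) \<subseteq> kippenhahn_lines A"
        by (auto simp: pencil_def power_mult_distrib intro!: in_lines)
      then show ?thesis unfolding kippenhahn_curve_contains_ellipse_def by blast
    next
      case False
      with \<open>s \<ge> 0\<close> have "s > 0" by simp
      have "z \<in> kippenhahn_curve A" if "z \<in> ellipse (of_real (sqrt 2)) (- of_real (sqrt 2)) (sqrt (s + 2))" for z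
      proof -
        have "s * (Re z)\<^sup>2 + (s + 2) * (Im z)\<^sup>2 = s * (s + 2)"
          using ellipse_equation[OF that] \<open>s > 0\<close> by (simp add: mult.commute)
        from ellipse_tangent[OF \<open>s > 0\<close> this] obtain t where t:
          "Re (cis t * z) - sqrt (s + 2 * (cos t)\<^sup>2) = 0"
          "((\<lambda>u. Re (cis u * z) - sqrt (s + 2 * (cos u)\<^sup>2)) has_real_derivative 0) (at t)" by blast
        moreover have "\<forall>\<^sub>F u in nhds t. line u (sqrt (s + 2 * (cos u)\<^sup>2)) \<in> kippenhahn_lines A"
          using \<open>s > 0\<close> by (intro always_eventually allI in_lines) simp
        ultimately show ?thesis
          unfolding kippenhahn_curve_def envelope_def
          by (intro CollectI exI[of _ "\<lambda>u. sqrt (s + 2 * (cos u)\<^sup>2)"] exI[of _ t] conjI)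
      qed
      moreover have "dist (of_real (sqrt 2)) (- of_real (sqrt 2) :: complex) < 2 * sqrt (s + 2)"
        using \<open>s > 0\<close> by (simp add: dist_norm flip: of_real_add)
      ultimately show ?thesis unfolding kippenhahn_curve_contains_ellipse_def by blast
    qed
  qed
  moreover have "\<eta> j = \<xi> j" if "j \<in> {1..6}" for j using assms(2)[OF that] by (simp add: \<eta>_def)
  ultimately show ?thesis unfolding confocal_iff by simp
qed

end
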